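(* Consider a power series $f(z)=\sum_{k=0}^\infty d_kz^k$ with $d_k\in\mathbb{C}\setminus\{0\}$ for all $k$. For $n\in\mathbb{Z}_+=\{0,1,2,\dots\}$ define $$f_n(z)=\sum_{k=0}^n d_kz^k,\qquad F_n(z)=\frac1{d_n}f_n(z),$$ and put $f_{-1}:=0$. Then $$\frac1{d_n}\bigl(f_n(z)-f_{n-1}(z)\bigr)=z^n,\qquad n\in\mathbb{Z}_+,$$ and the monic polynomials $F_n$ satisfy the recurrence relation $$F_n(z)=\left(z+\frac{d_{n-1}}{d_n}\right)F_{n-1}(z)-\frac{d_{n-2}}{d_{n-1}}\,z\,F_{n-2}(z),\qquad n=1,2,\dots,$$ where $F_{-1}(z):=0$ and $d_{-1}:=1$. Consequently, the polynomials $F_n(z)$ are related to biorthogonal rational functions.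
   Context: Background for the last sentence: an $R_I$-type continued fraction is associated with a system of monic polynomials $\{P_n(z)\}_{n\ge0}$ generated by $P_n(z)=(z-\mathbf{c}_n)P_{n-1}(z)-\lambda_n(z-\mathbf{a}_n)P_{n-2}(z)$, $n=1,2,\dots$, $P_{-1}:=0$, $P_0:=1$, with $\lambda_{n+1}\neq0$, $P_n(\mathbf{a}_n)\neq0$; such polynomials are related to biorthogonal rational functions (Ismail and Masson, 1995). *)

theory Defs
  imports "HOL-Computational_Algebra.Computational_Algebra" Complex_Main
begin

text \<open>
  Indices are integers, because the recurrence at \<open>n = 1\<close> uses the conventions
  \<open>d_{-1} = 1\<close>, \<open>f_{-1} = 0\<close>, \<open>F_{-1} = 0\<close>.  Only the indices \<open>\<ge> -1\<close> are meaningful.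
\<close>

definition dcoeff :: "complex fps \<Rightarrow> int \<Rightarrow> complex" where
  "dcoeff f n = (if n < 0 then 1 else fps_nth f (nat n))"

definition psum :: "complex fps \<Rightarrow> int \<Rightarrow> complex poly" where
  "psum f n = (if n < 0 then 0 else (\<Sum>k\<le>nat n. monom (fps_nth f k) k))"

definition Fpoly :: "complex fps \<Rightarrow> int \<Rightarrow> complex poly" where
  "Fpoly f n = smult (1 / dcoeff f n) (psum f n)"

text \<open>
  The values \<open>c n\<close>, \<open>lam n\<close>, \<open>a n\<close> matter only for \<open>n \<ge> 1\<close>; since \<open>P (-1) = 0\<close>, the value
  \<open>lam 1\<close> is irrelevant, whence the condition on \<open>lam (n + 1)\<close>.
\<close>

definition R_I_system ::
  "(int \<Rightarrow> complex) \<Rightarrow> (int \<Rightarrow> complex) \<Rightarrow> (int \<Rightarrow> complex) \<Rightarrow> (int \<Rightarrow> complex poly) \<Rightarrow> bool" where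
  "R_I_system c lam a P \<longleftrightarrow>
     P (-1) = 0 \<and> P 0 = 1 \<and>
     (\<forall>n\<ge>1. P n = [:- c n, 1:] * P (n - 1) - smult (lam n) ([:- a n, 1:] * P (n - 2))) \<and>
     (\<forall>n\<ge>1. lam (n + 1) \<noteq> 0 \<and> poly (P n) (a n) \<noteq> 0)"

text \<open>
  Biorthogonality in the sense of Ismail and Masson (Generalized orthogonality and continued
  fractions, 1995).  The \<open>R_I\<close> polynomial \<open>P n\<close> gives the rational function
  \<open>R_n(z) = P_n(z) / ((z - a_2) ... (z - a_{n+1}))\<close>; their Favard-type theorem supplies a linear
  functional \<open>L\<close>, on the rational functions \<open>p(z) / ((z - a_2) ... (z - a_{n+1}))\<close>, with
  \<open>L (z^k R_n) = 0\<close> for \<open>k < n\<close>.  Accordingly the partner functions are polynomials \<open>Q m\<close>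
  of degree \<open>m\<close>.  Rational functions are elements of the field of fractions of \<open>complex poly\<close>.
\<close>

definition pole_prod :: "(int \<Rightarrow> complex) \<Rightarrow> nat \<Rightarrow> complex poly" where
  "pole_prod a n = (\<Prod>j=1..n. [:- a (int j + 1), 1:])"

definition ratfun_space :: "(int \<Rightarrow> complex) \<Rightarrow> complex poly fract set" where
  "ratfun_space a = {to_fract p / to_fract (pole_prod a n) | p n. True}"

definition linear_functional_on ::
  "complex poly fract set \<Rightarrow> (complex poly fract \<Rightarrow> complex) \<Rightarrow> bool" where
  "linear_functional_on V L \<longleftrightarrow>
     (\<forall>r\<in>V. \<forall>s\<in>V. L (r + s) = L r + L s) \<and>
     (\<forall>c. \<forall>r\<in>V. L (to_fract [:c:] * r) = c * L r)"

definition biorthogonal ::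
  "(complex poly fract \<Rightarrow> complex) \<Rightarrow> (nat \<Rightarrow> complex poly fract) \<Rightarrow>
   (nat \<Rightarrow> complex poly fract) \<Rightarrow> bool" where
  "biorthogonal L R S \<longleftrightarrow> (\<forall>n m. L (R n * S m) \<noteq> 0 \<longleftrightarrow> n = m)"

definition biorthogonal_rational_functions ::
  "(int \<Rightarrow> complex) \<Rightarrow> (int \<Rightarrow> complex poly) \<Rightarrow> bool" where
  "biorthogonal_rational_functions a P \<longleftrightarrow>
     (\<exists>L Q. linear_functional_on (ratfun_space a) L \<and>
        (\<forall>m. degree (Q m) = m) \<and>
        biorthogonal L (\<lambda>n. to_fract (P (int n)) / to_fract (pole_prod a n))
                       (\<lambda>m. to_fract (Q m)))"

end

theory Submission
  imports Defs
begin

text \<open>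
  All the \<open>a n\<close> vanish, so the rational functions in question are the Laurent polynomials.
  A power series \<open>g\<close> induces on them the functional \<open>L\<close> with \<open>L (z^(-j)) = g_j\<close> for \<open>j \<ge> 0\<close>
  and \<open>L (z^j) = 0\<close> for \<open>j > 0\<close>; thus \<open>L (p / z^n)\<close> is the \<open>n\<close>-th coefficient of \<open>p g\<close>.
  For \<open>g = 1 / f\<close> the value \<open>L (f_n z^m / z^n)\<close> is the \<open>(n - m)\<close>-th coefficient of \<open>f_n / f\<close>,
  which is that of \<open>f / f = 1\<close>. Hence the \<open>F_n / z^n\<close> are biorthogonal to the monomials \<open>z^m\<close>.
\<close>

definition laurent_functional :: "complex fps \<Rightarrow> complex poly fract \<Rightarrow> complex" where
  "laurent_functional g r =
     (let (p, n) = SOME (p, n). r = to_fract p / to_fract (monom 1 n)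
      in fps_nth (fps_of_poly p * g) n)"

lemma to_fract_divide_eq_iff:
  assumes "q \<noteq> 0" and "q' \<noteq> 0"
  shows "to_fract p / to_fract q = to_fract p' / to_fract q' \<longleftrightarrow> p * q' = p' * q"
  using assms by (simp add: frac_eq_eq flip: to_fract_mult)

text \<open>Shows that the representation picked by \<open>SOME\<close> does not matter. If
  \<open>p / z^n = q / z^m\<close>, then \<open>z^m p g = z^n q g\<close>; the coefficient of index
  \<open>m + n\<close> is the \<open>n\<close>-th one of \<open>p g\<close> on the left and the
  \<open>m\<close>-th one of \<open>q g\<close> on the right.\<close>

lemma laurent_functional_divide_monom:
  "laurent_functional g (to_fract p / to_fract (monom 1 n)) = fps_nth (fps_of_poly p * g) n"
proof -
  define r where "r = to_fract p / to_fract (monom 1 n)"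
  define s where "s = (SOME (p, n). r = to_fract p / to_fract (monom 1 n))"
  obtain q m where s: "s = (q, m)"
    by fastforce
  have "case s of (q, m) \<Rightarrow> r = to_fract q / to_fract (monom 1 m)"
    unfolding s_def by (rule someI[of _ "(p, n)"]) (simp add: r_def)
  then have "p * monom 1 m = q * monom 1 n"
    unfolding s r_def by (simp add: to_fract_divide_eq_iff)
  then have "fps_of_poly p * fps_X ^ m = fps_of_poly q * fps_X ^ n"
    by (simp flip: fps_of_poly_monom' fps_of_poly_mult)
  then have "fps_X ^ m * (fps_of_poly p * g) = fps_X ^ n * (fps_of_poly q * g)"
    by (metis mult.assoc mult.commute)
  then have "fps_nth (fps_X ^ m * (fps_of_poly p * g)) (m + n) =
      fps_nth (fps_X ^ n * (fps_of_poly q * g)) (m + n)"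
    by (simp only:)
  then have "fps_nth (fps_of_poly p * g) n = fps_nth (fps_of_poly q * g) m"
    by (simp add: fps_X_power_mult_nth)
  moreover have "laurent_functional g r = fps_nth (fps_of_poly q * g) m"
    unfolding laurent_functional_def s_def[symmetric] s by simp
  ultimately show ?thesis
    by (simp add: r_def)
qed

lemma pole_prod_zero: "pole_prod (\<lambda>n. 0) n = monom 1 n"
  by (simp add: pole_prod_def monom_altdef)

lemma linear_functional_on_laurent_functional:
  "linear_functional_on (ratfun_space (\<lambda>n. 0)) (laurent_functional g)"
  unfolding linear_functional_on_def
proof (intro conjI ballI allI)
  fix r s
  assume "r \<in> ratfun_space (\<lambda>n. 0)" and "s \<in> ratfun_space (\<lambda>n. 0)"
  then obtain p n q m where
    r: "r = to_fract p / to_fract (monom 1 n)" and s: "s = to_fract q / to_fract (monom 1 m)"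
    by (auto simp: ratfun_space_def pole_prod_zero)
  \<comment> \<open>Over the common denominator \<open>z^(n+m)\<close>, additivity reduces to that
    of a single coefficient in the numerator.\<close>
  have r': "r = to_fract (p * monom 1 m) / to_fract (monom 1 (n + m))"
    unfolding r by (subst to_fract_divide_eq_iff) (auto simp: mult_monom mult_ac add.commute)
  have s': "s = to_fract (q * monom 1 n) / to_fract (monom 1 (n + m))"
    unfolding s by (subst to_fract_divide_eq_iff) (auto simp: mult_monom mult_ac add.commute)
  have rs: "r + s = to_fract (p * monom 1 m + q * monom 1 n) / to_fract (monom 1 (n + m))"
    unfolding r' s' to_fract_add add_divide_distrib ..
  show "laurent_functional g (r + s) = laurent_functional g r + laurent_functional g s"
    unfolding rs laurent_functional_divide_monom
    unfolding r' s' laurent_functional_divide_monom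
    by (simp add: fps_of_poly_add distrib_right)
next
  fix c r
  assume "r \<in> ratfun_space (\<lambda>n. 0)"
  then obtain p n where r: "r = to_fract p / to_fract (monom 1 n)"
    by (auto simp: ratfun_space_def pole_prod_zero)
  have "to_fract [:c:] * r = to_fract (smult c p) / to_fract (monom 1 n)"
    by (simp add: r flip: to_fract_mult)
  then show "laurent_functional g (to_fract [:c:] * r) = c * laurent_functional g r"
    by (simp add: r laurent_functional_divide_monom fps_of_poly_smult mult.assoc)
qed

lemma psum_rec:
  assumes "n \<ge> 0"
  shows "psum f n = psum f (n - 1) + monom (dcoeff f n) (nat n)"
proof (cases "n = 0")
  case False
  then obtain k where "n = int (Suc k)"
    using assms by (metis not0_implies_Suc of_nat_0 zero_le_imp_eq_int)
  then show ?thesis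
    by (simp add: psum_def dcoeff_def nat_add_distrib)
qed (simp add: psum_def dcoeff_def)

lemma coeff_psum: "coeff (psum f (int n)) k = (if k \<le> n then fps_nth f k else 0)"
  by (simp add: psum_def coeff_sum)

lemma dcoeff_nonzero:
  assumes "\<And>k. fps_nth f k \<noteq> 0"
  shows "dcoeff f n \<noteq> 0"
  using assms by (simp add: dcoeff_def)

lemma coeff_Fpoly:
  "coeff (Fpoly f (int n)) k = (if k \<le> n then fps_nth f k / fps_nth f n else 0)"
  by (simp add: Fpoly_def coeff_psum dcoeff_def)

lemma Fpoly_monic:
  assumes "fps_nth f n \<noteq> 0"
  shows "degree (Fpoly f (int n)) = n" and "lead_coeff (Fpoly f (int n)) = 1"
proof -
  show "degree (Fpoly f (int n)) = n"
    using assms by (intro antisym degree_le le_degree) (auto simp: coeff_Fpoly)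
  then show "lead_coeff (Fpoly f (int n)) = 1"
    using assms by (simp add: coeff_Fpoly)
qed

text \<open>Dividing \<open>f_n = f_{n-1} + d_n z^n\<close> by \<open>d_n\<close> gives
  \<open>F_n = f_{n-1} / d_n + z * z^(n-1)\<close>, and the same identity one index lower gives
  \<open>z^(n-1) = F_{n-1} - f_{n-2} / d_{n-1}\<close>. It remains to rewrite \<open>f_{n-1}\<close>
  and \<open>f_{n-2}\<close> as multiples of \<open>F_{n-1}\<close> and
  \<open>F_{n-2}\<close>.\<close>

lemma Fpoly_rec:
  assumes nz: "\<And>k. fps_nth f k \<noteq> 0" and "n \<ge> 1"
  shows "Fpoly f n =
    [:dcoeff f (n - 1) / dcoeff f n, 1:] * Fpoly f (n - 1)
    - smult (dcoeff f (n - 2) / dcoeff f (n - 1)) ([:0, 1:] * Fpoly f (n - 2))"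
proof -
  have d: "dcoeff f k \<noteq> 0" for k
    using nz by (rule dcoeff_nonzero)
  have n: "psum f n = psum f (n - 1) + monom (dcoeff f n) (nat n)"
    using assms by (intro psum_rec) simp
  have n1: "psum f (n - 1) = psum f (n - 2) + monom (dcoeff f (n - 1)) (nat (n - 1))"
    using assms psum_rec[of "n - 1" f] by simp
  have "nat n = Suc (nat (n - 1))"
    using assms by simp
  then have Fn: "Fpoly f n = smult (1 / dcoeff f n) (psum f (n - 1)) + pCons 0 (monom 1 (nat (n - 1)))"
    using d by (simp add: Fpoly_def n smult_add_right smult_monom monom_Suc)
  have F1: "Fpoly f (n - 1) =
      smult (1 / dcoeff f (n - 1)) (psum f (n - 2)) + monom 1 (nat (n - 1))"
    using d by (simp add: Fpoly_def n1 smult_add_right smult_monom)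
  have "[:dcoeff f (n - 1) / dcoeff f n, 1:] * Fpoly f (n - 1) =
      smult (1 / dcoeff f n) (psum f (n - 1)) + pCons 0 (Fpoly f (n - 1))"
    using d by (simp add: Fpoly_def smult_add_right)
  \<comment> \<open>For \<open>n = 1\<close> both sides vanish, because
    \<open>psum f (-1) = 0\<close>.\<close>
  moreover have "smult (dcoeff f (n - 2) / dcoeff f (n - 1)) ([:0, 1:] * Fpoly f (n - 2)) =
      pCons 0 (smult (1 / dcoeff f (n - 1)) (psum f (n - 2)))"
    using d by (simp add: Fpoly_def)
  ultimately show ?thesis
    by (simp add: Fn F1)
qed

lemma Fpoly_R_I_system:
  assumes nz: "\<And>k. fps_nth f k \<noteq> 0"
  shows "R_I_system (\<lambda>n. - (dcoeff f (n - 1) / dcoeff f n))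
    (\<lambda>n. dcoeff f (n - 2) / dcoeff f (n - 1)) (\<lambda>n. 0) (Fpoly f)"
  unfolding R_I_system_def
proof (intro conjI allI impI)
  show "Fpoly f (- 1) = 0"
    by (simp add: Fpoly_def psum_def)
  show "Fpoly f 0 = 1"
    using nz by (simp add: Fpoly_def psum_def dcoeff_def smult_monom)
  fix n :: int
  assume n: "n \<ge> 1"
  show "Fpoly f n = [:- (- (dcoeff f (n - 1) / dcoeff f n)), 1:] * Fpoly f (n - 1)
      - smult (dcoeff f (n - 2) / dcoeff f (n - 1)) ([:- 0, 1:] * Fpoly f (n - 2))"
    using Fpoly_rec[OF nz n] by simp
  show "dcoeff f (n + 1 - 2) / dcoeff f (n + 1 - 1) \<noteq> 0"
    using dcoeff_nonzero[OF nz] by simp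
  obtain k where "n = int k"
    using n by (metis zero_le_imp_eq_int order_trans zero_le_one)
  \<comment> \<open>The value at 0 is the constant coefficient \<open>d_0 / d_n\<close>.\<close>
  then show "poly (Fpoly f n) 0 \<noteq> 0"
    using nz by (simp add: poly_0_coeff_0 coeff_Fpoly)
qed

text \<open>Coefficients of a product up to index \<open>n\<close> involve only the coefficients of
  the factors up to \<open>n\<close>, so truncating \<open>f\<close> there changes none of them, and
  \<open>f * inverse f = 1\<close>.\<close>

lemma coeff_psum_mult_inverse:
  assumes "fps_nth f 0 \<noteq> 0" and "k \<le> n"
  shows "fps_nth (fps_of_poly (psum f (int n)) * inverse f) k = (if k = 0 then 1 else 0)"
proof -
  have "fps_nth (fps_of_poly (psum f (int n)) * inverse f) k = fps_nth (f * inverse f) k"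
    using assms(2) by (auto simp: fps_mult_nth coeff_psum intro!: sum.cong)
  then show ?thesis
    using assms(1) by (simp add: inverse_mult_eq_1')
qed

lemma biorthogonal_Fpoly_monom:
  assumes nz: "\<And>k. fps_nth f k \<noteq> 0"
  shows "biorthogonal (laurent_functional (inverse f))
    (\<lambda>n. to_fract (Fpoly f (int n)) / to_fract (monom 1 n)) (\<lambda>m. to_fract (monom 1 m))"
  unfolding biorthogonal_def
proof (intro allI)
  fix n m :: nat
  define r where
    "r = to_fract (Fpoly f (int n)) / to_fract (monom 1 n) * to_fract (monom 1 m)"
  have "r = to_fract (monom 1 m * Fpoly f (int n)) / to_fract (monom 1 n)"
    by (simp add: r_def mult.commute)
  then have "laurent_functional (inverse f) r =
      fps_nth (fps_of_poly (monom 1 m * Fpoly f (int n)) * inverse f) n"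
    by (simp only: laurent_functional_divide_monom)
  also have "\<dots> = fps_nth (fps_X ^ m * (fps_of_poly (Fpoly f (int n)) * inverse f)) n"
    by (simp add: fps_of_poly_mult fps_of_poly_monom' mult.assoc)
  \<comment> \<open>If \<open>m > n\<close>, the factor \<open>fps_X ^ m\<close> annihilates the
    coefficient. Otherwise the one of index \<open>n - m \<le> n\<close> remains, which vanishes
    unless \<open>n = m\<close>; the factor \<open>1 / d_n\<close> comes from normalizing
    \<open>psum\<close> to \<open>Fpoly\<close>.\<close>
  also have "\<dots> = (if n = m then 1 / dcoeff f (int n) else 0)"
    using coeff_psum_mult_inverse[OF nz, of "n - m" n]
    by (auto simp: fps_X_power_mult_nth Fpoly_def fps_of_poly_smult mult.assoc)
  finally show "laurent_functional (inverse f) r \<noteq> 0 \<longleftrightarrow> n = m"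
    using dcoeff_nonzero[OF nz] by simp
qed

theorem mainTheorem3:
  fixes f :: "complex fps"
  assumes "\<And>k. fps_nth f k \<noteq> 0"
  shows "(\<forall>n\<ge>0. smult (1 / dcoeff f n) (psum f n - psum f (n - 1)) = monom 1 (nat n)) \<and>
    (\<forall>n\<ge>0. degree (Fpoly f n) = nat n \<and> lead_coeff (Fpoly f n) = 1) \<and>
    (\<forall>n\<ge>1. Fpoly f n =
        [:dcoeff f (n - 1) / dcoeff f n, 1:] * Fpoly f (n - 1)
        - smult (dcoeff f (n - 2) / dcoeff f (n - 1)) ([:0, 1:] * Fpoly f (n - 2))) \<and>
    R_I_system (\<lambda>n. - (dcoeff f (n - 1) / dcoeff f n))
               (\<lambda>n. dcoeff f (n - 2) / dcoeff f (n - 1)) (\<lambda>n. 0) (Fpoly f) \<and>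
    biorthogonal_rational_functions (\<lambda>n. 0) (Fpoly f)"
proof (intro conjI allI impI)
  fix n :: int
  assume n: "n \<ge> 0"
  show "smult (1 / dcoeff f n) (psum f n - psum f (n - 1)) = monom 1 (nat n)"
    using dcoeff_nonzero[OF assms] by (simp add: psum_rec[OF n] smult_monom)
  show "degree (Fpoly f n) = nat n" and "lead_coeff (Fpoly f n) = 1"
    using Fpoly_monic[of f "nat n"] assms n by simp_all
next
  fix n :: int
  assume "n \<ge> 1"
  with assms show "Fpoly f n =
        [:dcoeff f (n - 1) / dcoeff f n, 1:] * Fpoly f (n - 1)
        - smult (dcoeff f (n - 2) / dcoeff f (n - 1)) ([:0, 1:] * Fpoly f (n - 2))"
    by (rule Fpoly_rec)
next
  show "R_I_system (\<lambda>n. - (dcoeff f (n - 1) / dcoeff f n))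
               (\<lambda>n. dcoeff f (n - 2) / dcoeff f (n - 1)) (\<lambda>n. 0) (Fpoly f)"
    using assms by (rule Fpoly_R_I_system)
next
  \<comment> \<open>The partner polynomials are \<open>Q m = z^m\<close>, and the functional is the
    one induced by \<open>inverse f\<close>.\<close>
  have "degree (monom (1 :: complex) m) = m" for m
    by (simp add: degree_monom_eq)
  then show "biorthogonal_rational_functions (\<lambda>n. 0) (Fpoly f)"
    unfolding biorthogonal_rational_functions_def pole_prod_zero
    using linear_functional_on_laurent_functional biorthogonal_Fpoly_monom[OF assms] by blast
qed

end
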